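(* Consider a finite-horizon constrained MDP with occupancy-measure set $\Delta(\mathcal M)$, reward vector $r$, constraint functions $g_1,\dots,g_m$, true thresholds $\alpha\in[0,H]^m$ and pessimistic thresholds $\overline\alpha\in\mathbb R^m$, $\overline\alpha_i\ge\alpha_i$ for all $i\in[m]$. Assume: (A1) there exist a policy $\pi^0$ and $\xi\in\mathbb R_{>0}^m$ such that $V_{g_i}^{\pi^0}\ge\alpha_i+\xi_i$ for all $i\in[m]$; (A2) $\overline\alpha_i-\alpha_i<\xi_i$ for all $i\in[m]$. Then $$\min_{\lambda\in\mathbb R_{\ge0}^m}\ \max_{q\in\mathcal F_{\mathrm{pes}}}\mathcal L(q,\lambda)=\max_{q\in\mathcal F_{\mathrm{pes}}}\ \min_{\lambda\in\mathbb R_{\ge0}^m}\mathcal L(q,\lambda).$$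
   Context: $\mathcal S,\mathcal A$ are finite state and action sets, $H$ the horizon, $p_h(\cdot\mid s,a)$ the transition probabilities, $s_1$ a fixed initial state. A policy is $\pi=(\pi_1,\dots,\pi_H)$ with $\pi_h(\cdot\mid s)$ a probability distribution on $\mathcal A$. Rewards and constraint functions satisfy $r_h(s,a),g_{i,h}(s,a)\in[0,1]$, and $V_v^\pi=\mathbb E_{\pi,p}[\sum_{h=1}^Hv_h(s_h,a_h)\mid s_1]$. The occupancy measure of $\pi$ is $q_h^\pi(s,a;p)=\mathbb P(s_h=s,a_h=a\mid p,\pi)$, and $\Delta(\mathcal M)\subset\mathbb R^{H\times\mathcal S\times\mathcal A}$ is the set of all occupancy measures of policies, so that $V_r^\pi=r^\top q^\pi$ and $(V_{g_i}^\pi)_{i\in[m]}=G^\top q^\pi$ with $G$ the matrix whose $i$-th constraint vector is $(g_{i,h}(s,a))_{h,s,a}$. Define $$\mathcal L(q,\lambda)=r^\top q+\lambda^\top(G^\top q-\alpha),\qquad \mathcal F_{\mathrm{pes}}=\Big\{q\in\Delta(\mathcal M):\ \sum_{h,s,a}q_h(s,a)g_{i,h}(s,a)\ge\overline\alpha_i\ \ \forall i\in[m]\Big\}.$$ The pessimistic threshold $\overline\alpha$ is an upper confidence bound for $\alpha$. *)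

theory Defs
  imports "HOL-Probability.Probability"
begin

text \<open>
  Stages are numbered \<open>1, \<dots>, H\<close>.  A (Markov, time-dependent, randomised) policy is a family
  \<open>\<pi> h s\<close> of distributions on actions and the transition kernel a family \<open>p h s a\<close> of distributions
  on states; their values at stages outside \<open>{1..H}\<close> play no role.
\<close>

type_synonym ('s, 'a) policy = "nat \<Rightarrow> 's \<Rightarrow> 'a pmf"
type_synonym ('s, 'a) kernel = "nat \<Rightarrow> 's \<Rightarrow> 'a \<Rightarrow> 's pmf"
type_synonym ('s, 'a) stagefun = "nat \<Rightarrow> 's \<Rightarrow> 'a \<Rightarrow> real"

text \<open>
  \<open>rollout p \<pi> n h s\<close> is the law of the next \<open>n\<close> state-action pairs when the process is in state \<open>s\<close>
  at stage \<open>h\<close>.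
\<close>

primrec rollout ::
    "('s, 'a) kernel \<Rightarrow> ('s, 'a) policy \<Rightarrow> nat \<Rightarrow> nat \<Rightarrow> 's \<Rightarrow> ('s \<times> 'a) list pmf" where
  "rollout p \<pi> 0 h s = return_pmf []"
| "rollout p \<pi> (Suc n) h s =
     bind_pmf (\<pi> h s) (\<lambda>a.
     bind_pmf (p h s a) (\<lambda>s'.
     map_pmf (\<lambda>\<tau>. (s, a) # \<tau>) (rollout p \<pi> n (Suc h) s')))"

definition trajectory ::
    "('s, 'a) kernel \<Rightarrow> nat \<Rightarrow> 's \<Rightarrow> ('s, 'a) policy \<Rightarrow> ('s \<times> 'a) list pmf" where
  "trajectory p H s1 \<pi> = rollout p \<pi> H 1 s1"

text \<open>Lists are indexed from 0, so the pair \<open>(s_h, a_h)\<close> of a trajectory sits at position \<open>h - 1\<close>.\<close>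

definition state_at :: "nat \<Rightarrow> ('s \<times> 'a) list \<Rightarrow> 's" where
  "state_at h \<tau> = fst (\<tau> ! (h - 1))"

definition action_at :: "nat \<Rightarrow> ('s \<times> 'a) list \<Rightarrow> 'a" where
  "action_at h \<tau> = snd (\<tau> ! (h - 1))"

definition policy_value ::
    "('s, 'a) kernel \<Rightarrow> nat \<Rightarrow> 's \<Rightarrow> ('s, 'a) stagefun \<Rightarrow> ('s, 'a) policy \<Rightarrow> real" where
  "policy_value p H s1 v \<pi> =
     measure_pmf.expectation (trajectory p H s1 \<pi>)
       (\<lambda>\<tau>. \<Sum>h = 1..H. v h (state_at h \<tau>) (action_at h \<tau>))"

text \<open>
  A vector indexed by stages, states and actions is a function that is only inspected at stages
  \<open>{1..H}\<close>; occupancy measures are set to 0 elsewhere so that they are determined by these entries.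
\<close>

definition occupancy ::
    "('s, 'a) kernel \<Rightarrow> nat \<Rightarrow> 's \<Rightarrow> ('s, 'a) policy \<Rightarrow> ('s, 'a) stagefun" where
  "occupancy p H s1 \<pi> h s a =
     (if h \<in> {1..H}
      then measure_pmf.prob (trajectory p H s1 \<pi>) {\<tau>. state_at h \<tau> = s \<and> action_at h \<tau> = a}
      else 0)"

definition occupancy_set ::
    "('s, 'a) kernel \<Rightarrow> nat \<Rightarrow> 's \<Rightarrow> ('s, 'a) stagefun set" where
  "occupancy_set p H s1 = range (occupancy p H s1)"

definition stage_inner ::
    "nat \<Rightarrow> ('s::finite, 'a::finite) stagefun \<Rightarrow> ('s, 'a) stagefun \<Rightarrow> real" where
  "stage_inner H v q = (\<Sum>h = 1..H. \<Sum>s\<in>UNIV. \<Sum>a\<in>UNIV. v h s a * q h s a)"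

text \<open>The vector \<open>G\<^sup>T q\<close>, where \<open>g i\<close> is the \<open>i\<close>-th constraint vector.\<close>

definition constraint_vec ::
    "nat \<Rightarrow> ('m::finite \<Rightarrow> ('s::finite, 'a::finite) stagefun) \<Rightarrow> ('s, 'a) stagefun \<Rightarrow> real ^ 'm" where
  "constraint_vec H g q = (\<chi> i. stage_inner H (g i) q)"

definition lagrangian ::
    "nat \<Rightarrow> ('s::finite, 'a::finite) stagefun \<Rightarrow> ('m::finite \<Rightarrow> ('s, 'a) stagefun) \<Rightarrow> real ^ 'm \<Rightarrow>
     ('s, 'a) stagefun \<Rightarrow> real ^ 'm \<Rightarrow> real" where
  "lagrangian H r g \<alpha> q l = stage_inner H r q + l \<bullet> (constraint_vec H g q - \<alpha>)"

definition pessimistic_set ::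
    "('s::finite, 'a::finite) kernel \<Rightarrow> nat \<Rightarrow> 's \<Rightarrow> ('m::finite \<Rightarrow> ('s, 'a) stagefun) \<Rightarrow> real ^ 'm \<Rightarrow>
     ('s, 'a) stagefun set" where
  "pessimistic_set p H s1 g \<beta> =
     {q \<in> occupancy_set p H s1. \<forall>i. stage_inner H (g i) q \<ge> \<beta> $ i}"

definition nonneg_vecs :: "(real ^ 'm::finite) set" where
  "nonneg_vecs = {l. \<forall>i. 0 \<le> l $ i}"

text \<open>
  \<open>is_max_value S f v\<close> says that the maximum of \<open>f\<close> over \<open>S\<close> exists (is attained) and equals \<open>v\<close>.
\<close>

definition is_max_value :: "'b set \<Rightarrow> ('b \<Rightarrow> real) \<Rightarrow> real \<Rightarrow> bool" where
  "is_max_value S f v \<longleftrightarrow> (\<exists>x\<in>S. f x = v) \<and> (\<forall>x\<in>S. f x \<le> v)"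

definition is_min_value :: "'b set \<Rightarrow> ('b \<Rightarrow> real) \<Rightarrow> real \<Rightarrow> bool" where
  "is_min_value S f v \<longleftrightarrow> (\<exists>x\<in>S. f x = v) \<and> (\<forall>x\<in>S. v \<le> f x)"

end

theory Submission
  imports Defs
begin

text \<open>
  The margin assumptions (A1) and (A2) make the pessimistic set nonempty, and the set of policies is
  compact while occupancies depend continuously on the policy, so all the maxima over the pessimistic
  set are attained. On that set every constraint slack is nonnegative, hence the inner minimum over
  multipliers is attained at \<open>0\<close>. The pair formed by a reward-maximal \<open>q\<close> and the multiplier \<open>0\<close> is
  therefore a saddle point; no convexity of the set of occupancy measures is involved.
\<close>

text \<open>
  The probability that the state-action pair observed \<open>k\<close> steps after being in state \<open>s\<close> at stage \<open>h\<close>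
  is \<open>z\<close>. The policy enters through arbitrary real weights \<open>x\<close>, because \<open>pmf\<close> carries no topology in
  which compactness and continuity could be stated.
\<close>

primrec pair_prob ::
    "('s::finite, 'a::finite) kernel \<Rightarrow> (nat \<times> 's \<times> 'a \<Rightarrow> real) \<Rightarrow> nat \<Rightarrow> nat \<Rightarrow> 's \<Rightarrow> 's \<times> 'a \<Rightarrow> real"
where
  "pair_prob p x 0 h s z = (if fst z = s then x (h, s, snd z) else 0)"
| "pair_prob p x (Suc k) h s z =
     (\<Sum>a\<in>UNIV. x (h, s, a) * (\<Sum>s'\<in>UNIV. pmf (p h s a) s' * pair_prob p x k (Suc h) s' z))"

definition policy_weights :: "('s, 'a) policy \<Rightarrow> nat \<times> 's \<times> 'a \<Rightarrow> real" where
  "policy_weights \<pi> = (\<lambda>(h, s, a). pmf (\<pi> h s) a)"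

text \<open>A product of action simplices over all pairs of a stage in \<open>nat\<close> and a
  state. The interval bound places it in a box that is compact in the product topology.\<close>

definition weight_set :: "(nat \<times> 's \<times> 'a::finite \<Rightarrow> real) set" where
  "weight_set = {x. (\<forall>j. x j \<in> {0..1}) \<and> (\<forall>h s. (\<Sum>a\<in>UNIV. x (h, s, a)) = 1)}"

text \<open>By its recursion, \<open>pair_prob\<close> is a polynomial in finitely many coordinates
  of \<open>x\<close>, and coordinates are continuous in the product topology.\<close>

lemma continuous_on_pair_prob: "continuous_on A (\<lambda>x. pair_prob p x k h s z)"
proof (induction k arbitrary: h s)
  case 0
  have "continuous_on A (\<lambda>x. x (h, s, snd z))"
    by (rule continuous_on_subset[OF continuous_on_product_coordinates subset_UNIV])
  then show ?case
    by (cases "fst z = s") simp_all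
next
  case (Suc k)
  have "continuous_on A (\<lambda>x. x (h, s, a))" for a
    by (rule continuous_on_subset[OF continuous_on_product_coordinates subset_UNIV])
  then show ?case
    unfolding pair_prob.simps
    by (intro continuous_on_sum continuous_on_mult continuous_on_const Suc.IH)
qed

lemma pmf_rollout_nth:
  fixes p :: "('s::finite, 'a::finite) kernel"
  assumes "k < n"
  shows "pmf (map_pmf (\<lambda>\<tau>. \<tau> ! k) (rollout p \<pi> n h s)) z = pair_prob p (policy_weights \<pi>) k h s z"
  using assms
proof (induction k arbitrary: n h s)
  case 0
  then obtain n' where n: "n = Suc n'"
    using gr0_implies_Suc by blast
  \<comment> \<open>The first entry is fixed once the first action is drawn, so the rest of the
    rollout integrates out.\<close>
  have "map_pmf (\<lambda>\<tau>. \<tau> ! 0) (rollout p \<pi> n h s) = map_pmf (Pair s) (\<pi> h s)"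
    by (simp add: n map_bind_pmf pmf.map_comp o_def map_pmf_const bind_pmf_const)
      (simp add: map_pmf_def)
  moreover have "pmf (map_pmf (Pair s) (\<pi> h s)) z = pair_prob p (policy_weights \<pi>) 0 h s z"
  proof (cases "fst z = s")
    case True
    then have "z = Pair s (snd z)"
      by (metis prod.collapse)
    then have "pmf (map_pmf (Pair s) (\<pi> h s)) z = pmf (\<pi> h s) (snd z)"
      by (metis pmf_map_inj' inj_on_def prod.inject)
    with True show ?thesis
      by (simp add: policy_weights_def)
  next
    case False
    then have "z \<notin> set_pmf (map_pmf (Pair s) (\<pi> h s))"
      by auto
    with False show ?thesis
      by (simp add: pmf_eq_0_set_pmf)
  qed
  ultimately show ?case
    by simp
next
  case (Suc k)
  then obtain n' where n: "n = Suc n'" and k: "k < n'"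
    by (metis Suc_lessE)
  \<comment> \<open>Entry \<open>Suc k\<close> is entry \<open>k\<close> of the tail, which is a
    rollout from stage \<open>Suc h\<close>; hence the induction is for arbitrary \<open>n\<close>,
    \<open>h\<close> and \<open>s\<close>.\<close>
  have "map_pmf (\<lambda>\<tau>. \<tau> ! Suc k) (rollout p \<pi> n h s) =
      bind_pmf (\<pi> h s) (\<lambda>a. bind_pmf (p h s a) (\<lambda>s'.
        map_pmf (\<lambda>\<tau>. \<tau> ! k) (rollout p \<pi> n' (Suc h) s')))"
    by (simp add: n map_bind_pmf pmf.map_comp o_def)
  then show ?case
    by (simp add: pmf_bind integral_measure_pmf_real[of UNIV] Suc.IH[OF k] policy_weights_def
        mult.commute)
qed

lemma occupancy_eq_pair_prob:
  fixes p :: "('s::finite, 'a::finite) kernel"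
  assumes "h \<in> {1..H}"
  shows "occupancy p H s1 \<pi> h s a = pair_prob p (policy_weights \<pi>) (h - 1) 1 s1 (s, a)"
proof -
  have "{\<tau>. state_at h \<tau> = s \<and> action_at h \<tau> = a} = (\<lambda>\<tau>. \<tau> ! (h - 1)) -` {(s, a)}"
    by (auto simp: state_at_def action_at_def prod_eq_iff)
  then have "occupancy p H s1 \<pi> h s a =
      pmf (map_pmf (\<lambda>\<tau>. \<tau> ! (h - 1)) (rollout p \<pi> H 1 s1)) (s, a)"
    using assms by (simp add: occupancy_def trajectory_def pmf_map)
  also have "\<dots> = pair_prob p (policy_weights \<pi>) (h - 1) 1 s1 (s, a)"
    using assms by (intro pmf_rollout_nth) auto
  finally show ?thesis .
qed

lemma policy_value_eq_stage_inner:
  fixes p :: "('s::finite, 'a::finite) kernel"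
  shows "policy_value p H s1 v \<pi> = stage_inner H v (occupancy p H s1 \<pi>)"
proof -
  let ?M = "measure_pmf (trajectory p H s1 \<pi>)"
  let ?E = "\<lambda>h s a. {\<tau> :: ('s \<times> 'a) list. state_at h \<tau> = s \<and> action_at h \<tau> = a}"
  \<comment> \<open>Writing the stage reward as a finite combination of indicators turns its
    expectation into a combination of occupancy probabilities.\<close>
  have ind: "v h (state_at h \<tau>) (action_at h \<tau>) =
      (\<Sum>s\<in>UNIV. \<Sum>a\<in>UNIV. v h s a * indicat_real (?E h s a) \<tau>)" for h and \<tau> :: "('s \<times> 'a) list"
  proof -
    have "(\<Sum>s\<in>UNIV. \<Sum>a\<in>UNIV. v h s a * indicat_real (?E h s a) \<tau>) =
        (\<Sum>s\<in>UNIV. \<Sum>a\<in>UNIV. if action_at h \<tau> = a then if state_at h \<tau> = s then v h s a else 0 else 0)"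
      by (intro sum.cong refl) (simp add: indicator_def)
    then show ?thesis
      by simp
  qed
  have int: "integrable ?M (\<lambda>\<tau>. v h s a * indicat_real (?E h s a) \<tau>)" for h s a
    by (intro integrable_mult_right measure_pmf.integrable_const_bound[where B = 1]) auto
  have "policy_value p H s1 v \<pi> =
      (\<Sum>h = 1..H. \<Sum>s\<in>UNIV. \<Sum>a\<in>UNIV. v h s a * measure ?M (?E h s a))"
    unfolding policy_value_def
    by (subst ind) (simp only: Bochner_Integration.integral_sum Bochner_Integration.integrable_sum int
        integral_mult_right_zero Bochner_Integration.integral_indicator space_measure_pmf Int_UNIV_right)
  then show ?thesis
    by (simp add: stage_inner_def occupancy_def)
qed

text \<open>A family of weights that is a distribution at every stage and state comes from a policy
  through \<open>embed_pmf\<close>. This lets a maximiser found among weights be read back as a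
  policy.\<close>

lemma range_policy_weights:
  "range (policy_weights :: ('s, 'a::finite) policy \<Rightarrow> _) = weight_set"
proof (intro equalityI subsetI)
  fix x :: "nat \<times> 's \<times> 'a \<Rightarrow> real"
  assume "x \<in> range policy_weights"
  then show "x \<in> weight_set"
    by (auto simp: policy_weights_def weight_set_def pmf_le_1 sum_pmf_eq_1)
next
  fix x :: "nat \<times> 's \<times> 'a \<Rightarrow> real"
  assume x: "x \<in> weight_set"
  define \<pi> where "\<pi> h s = embed_pmf (\<lambda>a. x (h, s, a))" for h s
  have "pmf (\<pi> h s) a = x (h, s, a)" for h s a
    unfolding \<pi>_def using x
    by (intro pmf_embed_pmf) (auto simp: weight_set_def nn_integral_count_space_finite sum_ennreal)
  then have "x = policy_weights \<pi>"
    by (auto simp: policy_weights_def)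
  then show "x \<in> range policy_weights"
    by blast
qed

text \<open>Tychonoff's theorem for the box, which has infinitely many coordinates, cut by the
  closed conditions that weights sum to 1.\<close>

lemma compact_weight_set: "compact (weight_set :: (nat \<times> 's \<times> 'a::finite \<Rightarrow> real) set)"
proof -
  let ?B = "PiE UNIV (\<lambda>_. {0..1}) :: (nat \<times> 's \<times> 'a \<Rightarrow> real) set"
  have "compactin (product_topology (\<lambda>_. euclidean) UNIV) ?B"
    by (subst compactin_PiE) auto
  then have "compact ?B"
    by (simp add: euclidean_product_topology)
  moreover have "closed {x :: nat \<times> 's \<times> 'a \<Rightarrow> real. \<forall>h s. (\<Sum>a\<in>UNIV. x (h, s, a)) = 1}"
    by (intro closed_Collect_all closed_Collect_eq continuous_on_sum continuous_on_const)
      (intro continuous_intros continuous_on_product_coordinates)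
  ultimately have "compact (?B \<inter> {x. \<forall>h s. (\<Sum>a\<in>UNIV. x (h, s, a)) = 1})"
    by (rule compact_Int_closed)
  also have "?B \<inter> {x. \<forall>h s. (\<Sum>a\<in>UNIV. x (h, s, a)) = 1} = weight_set"
    by (auto simp: weight_set_def)
  finally show ?thesis .
qed

text \<open>The extreme value theorem, applied to policy weights instead of occupancy measures. The
  objective \<open>v\<close> is arbitrary so that the Lagrangian at any fixed multiplier is
  covered.\<close>

lemma stage_inner_attains_max_on_pessimistic_set:
  fixes p :: "('s::finite, 'a::finite) kernel"
  assumes "pessimistic_set p H s1 g \<beta> \<noteq> {}"
  shows "\<exists>q\<in>pessimistic_set p H s1 g \<beta>. \<forall>q'\<in>pessimistic_set p H s1 g \<beta>.
           stage_inner H v q' \<le> stage_inner H v q"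
proof -
  define val where "val w x =
      stage_inner H w (\<lambda>h s a. pair_prob p x (h - 1) 1 s1 (s, a))" for w and x :: "nat \<times> 's \<times> 'a \<Rightarrow> real"
  have val: "stage_inner H w (occupancy p H s1 \<pi>) = val w (policy_weights \<pi>)" for w \<pi>
    unfolding val_def stage_inner_def
    by (intro sum.cong refl) (simp add: occupancy_eq_pair_prob del: One_nat_def)
  have cont: "continuous_on A (val w)" for A w
    unfolding val_def stage_inner_def
    by (intro continuous_on_sum continuous_on_mult continuous_on_const continuous_on_pair_prob)
  \<comment> \<open>The weights of exactly those policies whose occupancy is pessimistically
    feasible. The constraints are non-strict inequalities between continuous functions, so
    \<open>K\<close> is closed in \<open>weight_set\<close>.\<close>
  define K where "K = weight_set \<inter> {x. \<forall>i. \<beta> $ i \<le> val (g i) x}"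
  have K: "policy_weights \<pi> \<in> K \<longleftrightarrow> occupancy p H s1 \<pi> \<in> pessimistic_set p H s1 g \<beta>" for \<pi>
    using range_policy_weights
    by (auto simp: K_def pessimistic_set_def occupancy_set_def val)
  have "compact K"
    unfolding K_def
    by (intro compact_Int_closed compact_weight_set closed_Collect_all closed_Collect_le
        continuous_on_const cont)
  moreover have "K \<noteq> {}"
    using assms K by (fastforce simp: pessimistic_set_def occupancy_set_def)
  ultimately obtain x where x: "x \<in> K" "\<And>y. y \<in> K \<Longrightarrow> val v y \<le> val v x"
    using continuous_attains_sup[of K "val v"] cont by blast
  obtain \<pi> where \<pi>: "x = policy_weights \<pi>"
    using x(1) range_policy_weights unfolding K_def by blast
  show ?thesis
  proof (intro bexI ballI)
    show "occupancy p H s1 \<pi> \<in> pessimistic_set p H s1 g \<beta>"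
      using x(1) K \<pi> by simp
    fix q' assume q': "q' \<in> pessimistic_set p H s1 g \<beta>"
    then obtain \<pi>' where "q' = occupancy p H s1 \<pi>'"
      by (auto simp: pessimistic_set_def occupancy_set_def)
    then show "stage_inner H v q' \<le> stage_inner H v (occupancy p H s1 \<pi>)"
      using x(2)[of "policy_weights \<pi>'"] q' K \<pi> val by simp
  qed
qed

text \<open>For a fixed multiplier the Lagrangian is, up to a constant, the value of the combined
  reward. Each instance of \<open>sum.swap\<close> moves the sum over constraints inward past one
  other index.\<close>

lemma lagrangian_eq_stage_inner:
  fixes g :: "'m::finite \<Rightarrow> ('s::finite, 'a::finite) stagefun"
  shows "lagrangian H r g \<alpha> q l = stage_inner H (\<lambda>h s a. r h s a + (\<Sum>i\<in>UNIV. l $ i * g i h s a)) q - l \<bullet> \<alpha>"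
proof -
  have "l \<bullet> constraint_vec H g q = stage_inner H (\<lambda>h s a. \<Sum>i\<in>UNIV. l $ i * g i h s a) q"
    by (simp add: inner_vec_def constraint_vec_def stage_inner_def sum_distrib_left sum_distrib_right
        mult.assoc sum.swap[of _ "{Suc 0..H}" "UNIV :: 'm set"] sum.swap[of _ "UNIV :: 's set" "UNIV :: 'm set"]
        sum.swap[of _ "UNIV :: 'a set" "UNIV :: 'm set"])
  then show ?thesis
    by (simp add: lagrangian_def inner_diff_right stage_inner_def distrib_right sum.distrib)
qed

theorem lemma1:
  fixes p :: "('s::finite, 'a::finite) kernel"
    and H :: nat
    and s1 :: 's
    and r :: "('s, 'a) stagefun"
    and g :: "'m::finite \<Rightarrow> ('s, 'a) stagefun"
    and \<alpha> \<alpha>_pes \<xi> :: "real ^ 'm"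
    and \<pi>0 :: "('s, 'a) policy"
  assumes r_range: "\<And>h s a. h \<in> {1..H} \<Longrightarrow> r h s a \<in> {0..1}"
    and g_range: "\<And>i h s a. h \<in> {1..H} \<Longrightarrow> g i h s a \<in> {0..1}"
    and alpha_range: "\<And>i. \<alpha> $ i \<in> {0..real H}"
    and pessimistic: "\<And>i. \<alpha>_pes $ i \<ge> \<alpha> $ i"
    and xi_pos: "\<And>i. \<xi> $ i > 0"
    and slater: "\<And>i. policy_value p H s1 (g i) \<pi>0 \<ge> \<alpha> $ i + \<xi> $ i"
    and gap: "\<And>i. \<alpha>_pes $ i - \<alpha> $ i < \<xi> $ i"
  shows "\<exists>max_q min_l minmax maxmin.
      (\<forall>l\<in>nonneg_vecs.
         is_max_value (pessimistic_set p H s1 g \<alpha>_pes) (\<lambda>q. lagrangian H r g \<alpha> q l) (max_q l)) \<and>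
      is_min_value nonneg_vecs max_q minmax \<and>
      (\<forall>q\<in>pessimistic_set p H s1 g \<alpha>_pes.
         is_min_value nonneg_vecs (\<lambda>l. lagrangian H r g \<alpha> q l) (min_l q)) \<and>
      is_max_value (pessimistic_set p H s1 g \<alpha>_pes) min_l maxmin \<and>
      minmax = maxmin"
proof -
  let ?F = "pessimistic_set p H s1 g \<alpha>_pes"
  let ?L = "lagrangian H r g \<alpha>"
  \<comment> \<open>By (A2) and (A1), \<open>\<alpha>_pes $ i\<close> lies below
    \<open>\<alpha> $ i + \<xi> $ i\<close>, hence below the value of \<open>\<pi>0\<close>.\<close>
  have "\<alpha>_pes $ i \<le> stage_inner H (g i) (occupancy p H s1 \<pi>0)" for i
    using slater[of i] gap[of i] by (simp add: policy_value_eq_stage_inner)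
  then have ne: "?F \<noteq> {}"
    by (auto simp: pessimistic_set_def occupancy_set_def)
  have "\<exists>v. is_max_value ?F (\<lambda>q. ?L q l) v" for l
    using stage_inner_attains_max_on_pessimistic_set[OF ne]
    unfolding is_max_value_def lagrangian_eq_stage_inner by fastforce
  then obtain max_q where max_q: "\<And>l. is_max_value ?F (\<lambda>q. ?L q l) (max_q l)"
    by metis
  have zero: "0 \<in> nonneg_vecs" "?L q 0 = stage_inner H r q" for q
    by (simp_all add: nonneg_vecs_def lagrangian_def)
  \<comment> \<open>Feasibility for \<open>\<alpha>_pes\<close> implies feasibility for
    \<open>\<alpha>\<close>, so the penalty term is nonnegative and vanishes at
    \<open>l = 0\<close>. Thus \<open>stage_inner H r\<close> serves as
    \<open>min_l\<close>.\<close>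
  have slack: "stage_inner H r q \<le> ?L q l" if "q \<in> ?F" "l \<in> nonneg_vecs" for q l
  proof -
    have "\<alpha> $ i \<le> stage_inner H (g i) q" for i
      using that(1) pessimistic[of i] order_trans by (fastforce simp: pessimistic_set_def)
    then have "0 \<le> l \<bullet> (constraint_vec H g q - \<alpha>)"
      using that(2) by (auto simp: inner_vec_def nonneg_vecs_def constraint_vec_def intro!: sum_nonneg)
    then show ?thesis
      by (simp add: lagrangian_def)
  qed
  obtain q where q: "q \<in> ?F" "?L q 0 = max_q 0"
    using max_q[of 0] by (auto simp: is_max_value_def)
  \<comment> \<open>For the reward-maximal \<open>q\<close>:
    \<open>max_q 0 = ?L q 0 \<le> ?L q l \<le> max_q l\<close>. Hence \<open>max_q 0\<close> is the
    common value of both sides.\<close>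
  have "max_q 0 \<le> max_q l" if "l \<in> nonneg_vecs" for l
    using slack[OF q(1) that] max_q[of l] q zero(2)[of q] unfolding is_max_value_def by fastforce
  then have "is_min_value nonneg_vecs max_q (max_q 0)"
    using zero(1) by (auto simp: is_min_value_def)
  moreover have "is_min_value nonneg_vecs (?L q') (stage_inner H r q')" if "q' \<in> ?F" for q'
    using slack[OF that] zero unfolding is_min_value_def by blast
  moreover have "is_max_value ?F (stage_inner H r) (max_q 0)"
    using max_q[of 0] by (simp add: zero(2))
  ultimately show ?thesis
    using max_q by blast
qed

end
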